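(* Let $\mathcal H$, $X$, $\Sigma$, $\widehat\Sigma$, $B$, $\epsilon$, $(\lambda_i)_{i\ge1}$ be as in the context; in particular, with probability at least $1-\epsilon$, for every unit vector $u\in\mathcal H$, $$\bigl|\langle \Sigma u,u\rangle-\langle\widehat\Sigma u,u\rangle\bigr|\le B(\langle\Sigma u,u\rangle)\quad\text{and}\quad \bigl|\langle \Sigma u,u\rangle-\langle\widehat\Sigma u,u\rangle\bigr|\le B(\langle\widehat\Sigma u,u\rangle).$$ Then, with probability at least $1-\epsilon$, for every $L>0$ and every $1/L$-Lipschitz function $f:\mathbb R\to\mathbb R$, $$\| f(\Sigma)- f(\widehat \Sigma) \|_{\infty} \leq \min_{\tau \geq 1} L^{-1}\left( B(\lambda_1)+ \sqrt{4\tau B(\lambda_1)^2 + 2\sum_{i=\tau+1}^{+\infty} \lambda_i^2}\right),$$ where the minimum is over positive integers $\tau$.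
   Context: $\mathcal H$ is a real separable Hilbert space with inner product $\langle\cdot,\cdot\rangle$, and $X$ is a random vector in $\mathcal H$ with covariance operator $\Sigma u=\mathbb E[\langle u,X-\mathbb E[X]\rangle (X-\mathbb E[X])]$, assumed to have finite trace. $\widehat\Sigma$ is an estimator of $\Sigma$ (a random operator on $\mathcal H$, function of an i.i.d. sample). Spectral notation: $$\Sigma u=\sum_{i\ge1}\lambda_i\langle u,p_i\rangle p_i,\qquad \widehat\Sigma u=\sum_{i\ge1}\widehat\lambda_i\langle u,q_i\rangle q_i,$$ where $\lambda_1\ge\lambda_2\ge\dots\ge0$ and $\widehat\lambda_1\ge\widehat\lambda_2\ge\dots\ge0$ are the eigenvalues, tending to $0$ (in finite dimension the sums are finite), and $(p_i)_{i\ge1}$, $(q_i)_{i\ge1}$ are corresponding orthonormal bases of $\mathcal H$ consisting of eigenvectors. $B:[0,\infty)\to[0,\infty)$ is a non-decreasing function with $B(t+a)\le B(t)+a/2$ for all $t,a\ge0$, and $\epsilon\in(0,1)$. A function $f$ is $1/L$-Lipschitz if $|f(s)-f(t)|\le|s-t|/L$ for all $s,t$. $f(\Sigma)u=\sum_i f(\lambda_i)\langle u,p_i\rangle p_i$, and similarly $f(\widehat\Sigma)u=\sum_i f(\widehat\lambda_i)\langle u,q_i\rangle q_i$. $\|\cdot\|_\infty$ is the operator norm. *)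

theory Defs
  imports "HOL-Probability.Probability"
begin

text \<open>A real separable Hilbert space is a type of sort
  \<open>{real_inner, banach, second_countable_topology}\<close>; for metric spaces, second
  countability is the same as separability.  Operators are functions \<open>'a \<Rightarrow> 'a\<close>.\<close>

definition covariance_operator ::
  "'w measure \<Rightarrow> ('w \<Rightarrow> 'a::{real_inner, banach, second_countable_topology}) \<Rightarrow> 'a \<Rightarrow> 'a"
  where "covariance_operator M X u =
    (let m = integral\<^sup>L M X
     in integral\<^sup>L M (\<lambda>\<omega>. inner u (X \<omega> - m) *\<^sub>R (X \<omega> - m)))"

text \<open>Bochner integrals of non-integrable functions are \<open>0\<close> by convention; the next
  predicate says that those in \<open>covariance_operator\<close> are genuine.\<close>

definition has_covariance_operator ::
  "'w measure \<Rightarrow> ('w \<Rightarrow> 'a::{real_inner, banach, second_countable_topology}) \<Rightarrow> bool"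
  where "has_covariance_operator M X \<longleftrightarrow>
    integrable M X \<and>
    (\<forall>u. integrable M (\<lambda>\<omega>. inner u (X \<omega> - integral\<^sup>L M X) *\<^sub>R (X \<omega> - integral\<^sup>L M X)))"

text \<open>Index sets of bases: \<open>{1..d}\<close> in dimension \<open>d\<close>, \<open>{1..}\<close> in infinite dimension.\<close>

definition basis_index_set :: "nat set \<Rightarrow> bool"
  where "basis_index_set I \<longleftrightarrow> I = {1..} \<or> (\<exists>d. I = {1..d})"

definition orthonormal_basis_on :: "nat set \<Rightarrow> (nat \<Rightarrow> 'a::real_inner) \<Rightarrow> bool"
  where "orthonormal_basis_on I e \<longleftrightarrow>
    (\<forall>i\<in>I. \<forall>j\<in>I. inner (e i) (e j) = (if i = j then 1 else 0)) \<and>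
    closure (span (e ` I)) = UNIV"

text \<open>For a nonnegative operator the trace does not depend on the orthonormal basis \<open>e\<close>.\<close>

definition finite_trace :: "nat set \<Rightarrow> (nat \<Rightarrow> 'a::real_inner) \<Rightarrow> ('a \<Rightarrow> 'a) \<Rightarrow> bool"
  where "finite_trace I e T \<longleftrightarrow> (\<lambda>i. inner (T (e i)) (e i)) summable_on I"

text \<open>In finite dimension the eigenvalue sequence \<open>lam\<close> is padded with zeros outside the
  index set, so that \<open>lam 1\<close> and tail sums of \<open>lam\<close> always make sense.\<close>

definition spectral_decomposition ::
  "nat set \<Rightarrow> (nat \<Rightarrow> real) \<Rightarrow> (nat \<Rightarrow> 'a::real_inner) \<Rightarrow> ('a \<Rightarrow> 'a) \<Rightarrow> bool"
  where "spectral_decomposition I lam e T \<longleftrightarrow>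
    orthonormal_basis_on I e \<and>
    (\<forall>i\<in>I. 0 \<le> lam i) \<and>
    (\<forall>i\<in>I. \<forall>j\<in>I. i \<le> j \<longrightarrow> lam j \<le> lam i) \<and>
    (\<forall>i. i \<notin> I \<longrightarrow> lam i = 0) \<and>
    lam \<longlonglongrightarrow> 0 \<and>
    (\<forall>i\<in>I. T (e i) = lam i *\<^sub>R e i) \<and>
    (\<forall>u. ((\<lambda>i. (lam i * inner u (e i)) *\<^sub>R e i) has_sum T u) I)"

text \<open>The operator \<open>f(T)\<close>, for \<open>T\<close> with spectral decomposition \<open>(lam, e)\<close>.\<close>

definition spectral_fun ::
  "nat set \<Rightarrow> (nat \<Rightarrow> real) \<Rightarrow> (nat \<Rightarrow> 'a::real_inner) \<Rightarrow> (real \<Rightarrow> real) \<Rightarrow> 'a \<Rightarrow> 'a"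
  where "spectral_fun I lam e f u = infsum (\<lambda>i. (f (lam i) * inner u (e i)) *\<^sub>R e i) I"

definition iid_sample ::
  "'w measure \<Rightarrow> ('w \<Rightarrow> 'a::topological_space) \<Rightarrow> nat \<Rightarrow> (nat \<Rightarrow> 'w \<Rightarrow> 'a) \<Rightarrow> bool"
  where "iid_sample M X n Y \<longleftrightarrow>
    prob_space.indep_vars M (\<lambda>_. borel) Y {1..n} \<and>
    (\<forall>i\<in>{1..n}. distr M borel (Y i) = distr M borel X)"

text \<open>A random operator computed from an \<open>n\<close>-sample, measurable in the strong sense.\<close>

definition operator_estimator ::
  "nat \<Rightarrow> ((nat \<Rightarrow> 'a::real_normed_vector) \<Rightarrow> 'a \<Rightarrow> 'a) \<Rightarrow> bool"
  where "operator_estimator n est \<longleftrightarrow>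
    (\<forall>u. (\<lambda>x. est x u) \<in> measurable (PiM {1..n} (\<lambda>_. borel)) borel)"

text \<open>The property \<open>P\<close> holds with probability at least \<open>c\<close>, i.e. throughout some event of
  probability at least \<open>c\<close>.  When \<open>{\<omega> \<in> space M. P \<omega>}\<close> is itself an event, this says that its
  probability is at least \<open>c\<close>; no measurability of that set is presupposed.\<close>

definition with_prob_at_least :: "'w measure \<Rightarrow> real \<Rightarrow> ('w \<Rightarrow> bool) \<Rightarrow> bool"
  where "with_prob_at_least M c P \<longleftrightarrow> (\<exists>A\<in>sets M. measure M A \<ge> c \<and> (\<forall>\<omega>\<in>A. P \<omega>))"

end

theory Submission
  imports Defs
begin

text \<open>On the good event \<open>S = \<Sigma>\<close> and \<open>T\<close>, the estimator, satisfy
  \<open>\<bar>\<langle>(S - T) u, u\<rangle>\<bar> \<le> b\<close> on unit vectors, where \<open>b = B (\<lambda>\<^sub>1)\<close>; hence the operator norm of \<open>S - T\<close>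
  is at most \<open>b\<close>, and the eigenvalues \<open>\<mu>\<^sub>k\<close> of \<open>T\<close> satisfy \<open>\<mu>\<^sub>k \<le> \<lambda>\<^sub>k + b\<close> (Weyl).  Between the two
  eigenbases, \<open>S - T\<close> has the entries \<open>(\<lambda>\<^sub>i - \<mu>\<^sub>k) \<langle>p\<^sub>i, q\<^sub>k\<rangle>\<close> and \<open>f(S) - f(T)\<close> the entries
  \<open>(f(\<lambda>\<^sub>i) - f(\<mu>\<^sub>k)) \<langle>p\<^sub>i, q\<^sub>k\<rangle>\<close>.  The first \<open>\<tau>\<close> rows and columns of the latter thus contribute at most
  \<open>2 \<tau> b\<^sup>2 / L\<^sup>2\<close> to its squared Hilbert-Schmidt norm.  In the remaining block replace \<open>\<mu>\<^sub>k\<close> by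
  \<open>c\<^sub>k = max (\<mu>\<^sub>k - b) 0 \<le> \<lambda>\<^sub>k\<close>: this costs \<open>b / L\<close> in operator norm, and since
  \<open>(\<lambda>\<^sub>i - c\<^sub>k)\<^sup>2 \<le> \<lambda>\<^sub>i\<^sup>2 + \<lambda>\<^sub>k\<^sup>2\<close>, what is left has squared Hilbert-Schmidt norm at most
  \<open>2 / L\<^sup>2\<close> times the sum of the \<open>\<lambda>\<^sub>i\<^sup>2\<close> over \<open>i > \<tau>\<close>.  This gives the bound even with \<open>2 \<tau>\<close> in place of \<open>4 \<tau>\<close>.\<close>

section \<open>Index sets of bases\<close>

lemma basis_index_set_pos: "basis_index_set I \<Longrightarrow> i \<in> I \<Longrightarrow> 1 \<le> i"
  unfolding basis_index_set_def by auto

lemma basis_index_set_down: "basis_index_set I \<Longrightarrow> k \<in> I \<Longrightarrow> {1..k} \<subseteq> I"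
  unfolding basis_index_set_def by auto

subsection \<open>Expansion in an orthonormal basis\<close>

lemma orthonormal_basis_onD:
  assumes "orthonormal_basis_on I e" "i \<in> I" "j \<in> I"
  shows "inner (e i) (e j) = (if i = j then 1 else 0)"
  using assms unfolding orthonormal_basis_on_def by blast

lemma inner_sum_orthonormal:
  assumes "orthonormal_basis_on I e" "finite F" "F \<subseteq> I" "j \<in> I"
  shows "inner (\<Sum>i\<in>F. a i *\<^sub>R e i) (e j) = (if j \<in> F then a j else 0)"
proof -
  have "inner (\<Sum>i\<in>F. a i *\<^sub>R e i) (e j) = (\<Sum>i\<in>F. if i = j then a j else 0)"
    unfolding inner_sum_left
    by (rule sum.cong) (use assms in \<open>auto simp: subset_eq orthonormal_basis_onD[OF assms(1)]\<close>)
  then show ?thesis using assms(2) by simp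
qed

lemma norm_sum_orthonormal:
  assumes "orthonormal_basis_on I e" "finite F" "F \<subseteq> I"
  shows "(norm (\<Sum>i\<in>F. a i *\<^sub>R e i))\<^sup>2 = (\<Sum>i\<in>F. (a i)\<^sup>2)"
proof -
  have "(norm (\<Sum>i\<in>F. a i *\<^sub>R e i))\<^sup>2 = (\<Sum>j\<in>F. a j * inner (\<Sum>i\<in>F. a i *\<^sub>R e i) (e j))"
    by (simp add: power2_norm_eq_inner inner_sum_right)
  also have "\<dots> = (\<Sum>j\<in>F. (a j)\<^sup>2)"
    by (rule sum.cong)
      (use assms(3) in \<open>auto simp: inner_sum_orthonormal[OF assms] subset_eq power2_eq_square\<close>)
  finally show ?thesis .
qed

lemma bessel_ineq:
  assumes "orthonormal_basis_on I e" "finite F" "F \<subseteq> I"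
  shows "(\<Sum>i\<in>F. (inner u (e i))\<^sup>2) \<le> (norm u)\<^sup>2"
proof -
  define s where "s = (\<Sum>i\<in>F. inner u (e i) *\<^sub>R e i)"
  have n: "inner s s = (\<Sum>i\<in>F. (inner u (e i))\<^sup>2)"
    using norm_sum_orthonormal[OF assms] unfolding s_def by (simp add: power2_norm_eq_inner)
  have "inner u s = (\<Sum>i\<in>F. (inner u (e i))\<^sup>2)"
    unfolding s_def inner_sum_right by (simp add: power2_eq_square)
  then have "inner (u - s) (u - s) = (norm u)\<^sup>2 - (\<Sum>i\<in>F. (inner u (e i))\<^sup>2)"
    using n by (simp add: inner_diff_left inner_diff_right inner_commute power2_norm_eq_inner)
  then show ?thesis using inner_ge_zero[of "u - s"] by linarith
qed

lemma summable_on_inner_square: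
  assumes "orthonormal_basis_on I e"
  shows "(\<lambda>i. (inner u (e i))\<^sup>2) summable_on I"
  by (rule nonneg_bdd_above_summable_on)
    (auto intro!: bdd_aboveI2[where M = "(norm u)\<^sup>2"] bessel_ineq[OF assms])

text \<open>By Pythagoras, enlarging a finite index set \<open>F0\<close> to \<open>F\<close> moves
  the partial sum by the square root of the sum of \<open>(a i)\<^sup>2\<close> over
  \<open>F - F0\<close>. Hence the net of finite partial sums is Cauchy, and completeness yields a
  limit.\<close>

lemma summable_on_orthonormal:
  fixes e :: "nat \<Rightarrow> 'a::{real_inner, banach}"
  assumes e: "orthonormal_basis_on I e" and a: "(\<lambda>i. (a i)\<^sup>2) summable_on I"
  shows "(\<lambda>i. a i *\<^sub>R e i) summable_on I"
proof -
  let ?f = "\<lambda>i. a i *\<^sub>R e i" and ?s = "infsum (\<lambda>i. (a i)\<^sup>2) I"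
  have "\<exists>P. eventually P (finite_subsets_at_top I) \<and>
      (\<forall>F F'. P F \<and> P F' \<longrightarrow> dist (sum ?f F) (sum ?f F') < r)" if "r > 0" for r
  proof -
    \<comment> \<open>The extra factor 1/2 turns the non-strict approximation into a distance
      strictly below \<open>r / 2\<close> from the sum over \<open>F0\<close>; two such sums are
      then less than \<open>r\<close> apart.\<close>
    have "(r / 2)\<^sup>2 / 2 > 0" using that by simp
    from infsum_finite_approximation[OF a this] obtain F0 where F0: "finite F0" "F0 \<subseteq> I"
      and d: "dist (\<Sum>i\<in>F0. (a i)\<^sup>2) ?s \<le> (r / 2)\<^sup>2 / 2" by blast
    define P where "P F \<longleftrightarrow> finite F \<and> F0 \<subseteq> F \<and> F \<subseteq> I" for F
    have ev: "eventually P (finite_subsets_at_top I)"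
      unfolding eventually_finite_subsets_at_top P_def using F0 by blast
    have close: "dist (sum ?f F) (sum ?f F0) < r / 2" if "P F" for F
    proof -
      have F: "finite F" "F0 \<subseteq> F" "F \<subseteq> I" using that by (auto simp: P_def)
      have "(dist (sum ?f F) (sum ?f F0))\<^sup>2 = (norm (sum ?f (F - F0)))\<^sup>2"
        unfolding dist_norm using F F0 by (subst sum_diff) auto
      also have "\<dots> = (\<Sum>i\<in>F - F0. (a i)\<^sup>2)"
        by (rule norm_sum_orthonormal[OF e]) (use F in auto)
      also have "\<dots> = (\<Sum>i\<in>F. (a i)\<^sup>2) - (\<Sum>i\<in>F0. (a i)\<^sup>2)"
        using F F0 by (subst sum_diff) auto
      also have "\<dots> \<le> ?s - (\<Sum>i\<in>F0. (a i)\<^sup>2)"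
        using finite_sum_le_infsum[OF a F(1) F(3)] by simp
      also have "\<dots> \<le> (r / 2)\<^sup>2 / 2" using abs_le_D2[OF d[unfolded dist_real_def]] by simp
      also have "\<dots> < (r / 2)\<^sup>2" using \<open>r > 0\<close> by simp
      finally show ?thesis by (rule power2_less_imp_less) (use \<open>r > 0\<close> in simp)
    qed
    have "dist (sum ?f F) (sum ?f F') < r" if "P F" "P F'" for F F'
      using dist_triangle2[of "sum ?f F" "sum ?f F'" "sum ?f F0"]
        close[OF that(1)] close[OF that(2)] by linarith
    with ev show ?thesis by blast
  qed
  then have "cauchy_filter (filtermap (sum ?f) (finite_subsets_at_top I))"
    by (simp add: cauchy_filter_metric_filtermap)
  then obtain l where "(sum ?f \<longlongrightarrow> l) (finite_subsets_at_top I)"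
    using cauchy_filter_convergent by (auto simp: convergent_filter_iff filterlim_def)
  then show ?thesis using summable_on_def has_sum_def by blast
qed

lemma has_sum_inner_left:
  "(g has_sum s) A \<Longrightarrow> ((\<lambda>i. inner (g i) v) has_sum inner s v) A"
  by (rule has_sum_bounded_linear[OF bounded_linear_inner_left])

lemma has_sum_finite_sum:
  fixes g :: "'i \<Rightarrow> 'k \<Rightarrow> 'b::topological_comm_monoid_add"
  assumes "finite F" "\<And>i. i \<in> F \<Longrightarrow> (g i has_sum s i) A"
  shows "((\<lambda>k. \<Sum>i\<in>F. g i k) has_sum (\<Sum>i\<in>F. s i)) A"
  using assms by (induction F rule: finite_induct) (simp_all add: has_sum_add has_sum_0)

lemma has_sum_inner_orthonormal:
  assumes e: "orthonormal_basis_on I e" and s: "((\<lambda>i. a i *\<^sub>R e i) has_sum s) I" and j: "j \<in> I"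
  shows "inner s (e j) = a j"
proof -
  have "((\<lambda>i. inner (a i *\<^sub>R e i) (e j)) has_sum inner s (e j)) I"
    using has_sum_inner_left[OF s] .
  moreover have "((\<lambda>i. inner (a i *\<^sub>R e i) (e j)) has_sum a j) I
      \<longleftrightarrow> ((\<lambda>i. a j) has_sum a j) {j}"
    by (rule has_sum_cong_neutral) (use j in \<open>auto simp: orthonormal_basis_onD[OF e]\<close>)
  moreover have "((\<lambda>i. a j) has_sum a j) {j}"
    using has_sum_finite[of "{j}" "\<lambda>i. a j"] by simp
  ultimately show ?thesis using has_sum_unique by blast
qed

text \<open>Bessel makes the series converge to some \<open>s\<close> with the same coefficients as
  \<open>u\<close>. So \<open>u - s\<close> is orthogonal to every \<open>e i\<close>, hence to the
  closure of their span, which is the whole space, and in particular to itself.\<close>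

lemma orthonormal_expansion:
  fixes e :: "nat \<Rightarrow> 'a::{real_inner, banach}"
  assumes e: "orthonormal_basis_on I e"
  shows "((\<lambda>i. inner u (e i) *\<^sub>R e i) has_sum u) I"
proof -
  have "(\<lambda>i. inner u (e i) *\<^sub>R e i) summable_on I"
    by (rule summable_on_orthonormal[OF e summable_on_inner_square[OF e]])
  then obtain s where s: "((\<lambda>i. inner u (e i) *\<^sub>R e i) has_sum s) I"
    by (auto simp: summable_on_def)
  let ?W = "{w. inner (u - s) w = 0}"
  have sub: "subspace ?W"
    by (auto simp: subspace_def inner_add_right)
  have "e ` I \<subseteq> ?W"
    using has_sum_inner_orthonormal[OF e s] by (auto simp: inner_diff_left)
  then have "closure (span (e ` I)) \<subseteq> ?W"
    by (intro closure_minimal span_minimal sub closed_hyperplane)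
  then have "u - s \<in> ?W" using e unfolding orthonormal_basis_on_def by blast
  then show ?thesis using s by simp
qed

lemma parseval:
  fixes e :: "nat \<Rightarrow> 'a::{real_inner, banach}"
  assumes e: "orthonormal_basis_on I e"
  shows "((\<lambda>i. inner u (e i) * inner (e i) v) has_sum inner u v) I"
  using has_sum_inner_left[OF orthonormal_expansion[OF e]] by simp

subsection \<open>Operators with a spectral decomposition\<close>

lemma spectral_decompositionD:
  assumes "spectral_decomposition I lam e T"
  shows "orthonormal_basis_on I e"
    and "0 \<le> lam i"
    and "i \<in> I \<Longrightarrow> j \<in> I \<Longrightarrow> i \<le> j \<Longrightarrow> lam j \<le> lam i"
    and "i \<notin> I \<Longrightarrow> lam i = 0"
    and "i \<in> I \<Longrightarrow> T (e i) = lam i *\<^sub>R e i"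
    and "((\<lambda>i. (lam i * inner u (e i)) *\<^sub>R e i) has_sum T u) I"
proof -
  show "0 \<le> lam i"
    using assms[unfolded spectral_decomposition_def] by (metis order_refl)
qed (use assms[unfolded spectral_decomposition_def] in blast)+

text \<open>The zero padding keeps the sequence decreasing beyond the dimension. Index 0 must be
  excluded, since it lies off \<open>I\<close> and \<open>lam 0\<close> is therefore 0.\<close>

lemma spectral_decomposition_le:
  assumes "basis_index_set I" "spectral_decomposition I lam e T" "1 \<le> i" "i \<le> j"
  shows "lam j \<le> lam i"
proof (cases "j \<in> I")
  case True
  then have "i \<in> I" using basis_index_set_down[OF assms(1) True] assms by auto
  then show ?thesis using spectral_decompositionD(3)[OF assms(2)] True assms by blast
next
  case False
  then show ?thesis using spectral_decompositionD(2,4)[OF assms(2)] by simp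
qed

lemma spectral_decomposition_linear:
  assumes T: "spectral_decomposition I lam e T"
  shows "linear T"
proof (rule linearI)
  note h = spectral_decompositionD(6)[OF T]
  fix u v :: 'a and c :: real
  have "((\<lambda>i. (lam i * inner (u + v) (e i)) *\<^sub>R e i) has_sum T u + T v) I"
    using has_sum_add[OF h[of u] h[of v]]
    by (simp add: inner_add_left distrib_left scaleR_add_left)
  then show "T (u + v) = T u + T v" using h has_sum_unique by blast
  have "((\<lambda>i. (lam i * inner (c *\<^sub>R u) (e i)) *\<^sub>R e i) has_sum c *\<^sub>R T u) I"
    using has_sum_scaleR[OF h[of u], of c] by (simp add: mult.left_commute)
  then show "T (c *\<^sub>R u) = c *\<^sub>R T u" using h has_sum_unique by blast
qed

lemma spectral_decomposition_form:
  assumes T: "spectral_decomposition I lam e T"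
  shows "((\<lambda>i. lam i * (inner u (e i) * inner (e i) v)) has_sum inner (T u) v) I"
  using has_sum_inner_left[OF spectral_decompositionD(6)[OF T]] by (simp add: mult.assoc)

lemma spectral_decomposition_symmetric:
  assumes T: "spectral_decomposition I lam e T"
  shows "inner (T u) v = inner u (T v)"
proof -
  have "((\<lambda>i. lam i * (inner u (e i) * inner (e i) v)) has_sum inner (T v) u) I"
    using spectral_decomposition_form[OF T, of v u]
    by (simp add: inner_commute mult.commute)
  then have "inner (T u) v = inner (T v) u"
    by (rule has_sum_unique[OF spectral_decomposition_form[OF T]])
  then show ?thesis by (simp only: inner_commute[of u])
qed

text \<open>Comparison with Parseval, term by term. The eigenvalue is bounded only where
  \<open>u\<close> has a component, so that in \<open>weyl_upper\<close> the bound can be used for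
  vectors orthogonal to the first eigenvectors.\<close>

lemma spectral_decomposition_form_le:
  fixes e :: "nat \<Rightarrow> 'a::{real_inner, banach}"
  assumes T: "spectral_decomposition I lam e T"
    and c: "\<And>i. i \<in> I \<Longrightarrow> inner u (e i) \<noteq> 0 \<Longrightarrow> lam i \<le> c"
  shows "inner (T u) u \<le> c * (norm u)\<^sup>2"
proof -
  have "((\<lambda>i. c * (inner u (e i) * inner (e i) u)) has_sum c * (norm u)\<^sup>2) I"
    using has_sum_cmult_right[OF parseval[OF spectral_decompositionD(1)[OF T]]]
    by (simp add: power2_norm_eq_inner)
  then show ?thesis
  proof (rule has_sum_mono[OF spectral_decomposition_form[OF T]])
    fix i assume "i \<in> I"
    then show "lam i * (inner u (e i) * inner (e i) u) \<le> c * (inner u (e i) * inner (e i) u)"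
      using c[OF \<open>i \<in> I\<close>]
      by (cases "inner u (e i) = 0") (simp_all add: inner_commute[of "e i"] mult_right_mono)
  qed
qed

lemma spectral_decomposition_form_ge:
  fixes e :: "nat \<Rightarrow> 'a::{real_inner, banach}"
  assumes T: "spectral_decomposition I lam e T"
    and c: "\<And>i. i \<in> I \<Longrightarrow> inner u (e i) \<noteq> 0 \<Longrightarrow> c \<le> lam i"
  shows "c * (norm u)\<^sup>2 \<le> inner (T u) u"
proof -
  have "((\<lambda>i. c * (inner u (e i) * inner (e i) u)) has_sum c * (norm u)\<^sup>2) I"
    using has_sum_cmult_right[OF parseval[OF spectral_decompositionD(1)[OF T]]]
    by (simp add: power2_norm_eq_inner)
  then show ?thesis
  proof (rule has_sum_mono[OF _ spectral_decomposition_form[OF T]])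
    fix i assume "i \<in> I"
    then show "c * (inner u (e i) * inner (e i) u) \<le> lam i * (inner u (e i) * inner (e i) u)"
      using c[OF \<open>i \<in> I\<close>]
      by (cases "inner u (e i) = 0") (simp_all add: inner_commute[of "e i"] mult_right_mono)
  qed
qed

text \<open>This rules out the default value of \<open>infsum\<close>: a Lipschitz \<open>f\<close>
  is bounded on the interval from 0 to \<open>lam 1\<close>, so the coefficients are square
  summable.\<close>

lemma spectral_fun_has_sum:
  fixes e :: "nat \<Rightarrow> 'a::{real_inner, banach}"
  assumes I: "basis_index_set I" and T: "spectral_decomposition I lam e T"
    and f: "K-lipschitz_on UNIV f"
  shows "((\<lambda>i. (f (lam i) * inner u (e i)) *\<^sub>R e i) has_sum spectral_fun I lam e f u) I"
proof -
  note e = spectral_decompositionD(1)[OF T]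
  define C where "C = \<bar>f 0\<bar> + K * lam 1"
  have K: "0 \<le> K" using f by (rule lipschitz_on_nonneg)
  have C: "\<bar>f (lam i)\<bar> \<le> C" if "i \<in> I" for i
  proof -
    have "\<bar>f (lam i) - f 0\<bar> \<le> K * lam i"
      using lipschitz_onD[OF f, of "lam i" 0] spectral_decompositionD(2)[OF T, of i]
      by (simp add: dist_real_def)
    moreover have "K * lam i \<le> K * lam 1"
      using spectral_decomposition_le[OF I T _ basis_index_set_pos[OF I that]] K
      by (simp add: mult_left_mono)
    ultimately show ?thesis unfolding C_def by linarith
  qed
  have "(\<lambda>i. C\<^sup>2 * (inner u (e i))\<^sup>2) summable_on I"
    by (rule summable_on_cmult_right[OF summable_on_inner_square[OF e]])
  then have "(\<lambda>i. (f (lam i) * inner u (e i))\<^sup>2) summable_on I"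
  proof (rule summable_on_comparison_test)
    fix i assume "i \<in> I"
    then have "(f (lam i))\<^sup>2 \<le> C\<^sup>2" using C abs_le_square_iff by fastforce
    then show "(f (lam i) * inner u (e i))\<^sup>2 \<le> C\<^sup>2 * (inner u (e i))\<^sup>2"
      by (simp add: power_mult_distrib mult_right_mono)
  qed simp
  then show ?thesis
    unfolding spectral_fun_def by (intro has_sum_infsum summable_on_orthonormal[OF e])
qed

subsection \<open>Comparison of two operators\<close>

text \<open>Polarization, applied to \<open>x\<close> and the multiple of \<open>A x\<close> that has the norm of \<open>x\<close>.\<close>

lemma norm_le_of_form_le:
  fixes A :: "'a::real_inner \<Rightarrow> 'a"
  assumes lin: "linear A" and sym: "\<And>x y. inner (A x) y = inner x (A y)"
    and form: "\<And>x. \<bar>inner (A x) x\<bar> \<le> b * (norm x)\<^sup>2"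
  shows "norm (A x) \<le> b * norm x"
proof (cases "x = 0 \<or> A x = 0")
  case True
  have "0 \<le> b * norm x" if "x \<noteq> 0"
    using order_trans[OF abs_ge_zero form[of x]] that by (simp add: zero_le_mult_iff)
  then show ?thesis using True linear_0[OF lin] by (cases "x = 0") auto
next
  case False
  define y where "y = (norm x / norm (A x)) *\<^sub>R A x"
  have ny: "norm y = norm x" using False by (simp add: y_def)
  have "inner (A (x + y)) (x + y) - inner (A (x - y)) (x - y) = 4 * inner (A x) y"
    using sym[of y x]
    by (simp add: linear_add[OF lin] linear_diff[OF lin] inner_add_left inner_add_right
        inner_diff_left inner_diff_right inner_commute)
  then have "4 * inner (A x) y \<le> b * (norm (x + y))\<^sup>2 + b * (norm (x - y))\<^sup>2"
    using form[of "x + y"] form[of "x - y"] by linarith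
  also have "\<dots> = b * (2 * (norm x)\<^sup>2 + 2 * (norm y)\<^sup>2)"
    by (simp add: power2_norm_eq_inner inner_add_left inner_add_right inner_diff_left
        inner_diff_right inner_commute algebra_simps)
  also have "\<dots> = 4 * (b * norm x * norm x)" by (simp add: ny power2_eq_square)
  also have "inner (A x) y = norm (A x) * norm x"
    using False by (simp add: y_def power2_norm_eq_inner[symmetric] power2_eq_square)
  finally show ?thesis using False by simp
qed

section \<open>Weyl's inequality for eigenvalues\<close>

text \<open>Dimension count: the projection \<open>P\<close> onto the span of the
  \<open>k - 1\<close> vectors \<open>w j\<close> cannot be injective on the
  \<open>k\<close>-dimensional span of the \<open>v i\<close>, and a vector killed by
  \<open>P\<close> has no component along any of these \<open>w j\<close>.\<close>

lemma exists_span_orthogonal: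
  fixes v w :: "nat \<Rightarrow> 'a::real_inner"
  assumes "orthonormal_basis_on I v" "{1..k} \<subseteq> I" "orthonormal_basis_on I w" "1 \<le> k"
  obtains u where "u \<in> span (v ` {1..k})" "u \<noteq> 0" "\<And>j. j \<in> {1..<k} \<Longrightarrow> inner u (w j) = 0"
proof -
  define P where "P x = (\<Sum>j\<in>{1..<k}. inner x (w j) *\<^sub>R w j)" for x
  have lin: "linear P"
    by (rule linearI)
      (simp_all add: P_def inner_add_left scaleR_add_left sum.distrib scaleR_sum_right)
  have von: "i \<in> {1..k} \<Longrightarrow> j \<in> {1..k} \<Longrightarrow> inner (v i) (v j) = (if i = j then 1 else 0)" for i j
    using assms(2) by (intro orthonormal_basis_onD[OF assms(1)]) auto
  have inj: "inj_on v {1..k}"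
    by (rule inj_onI) (metis von zero_neq_one)
  have ind: "independent (v ` {1..k})"
  proof (rule pairwise_orthogonal_independent)
    show "pairwise orthogonal (v ` {1..k})"
      unfolding pairwise_def orthogonal_def using von by auto
    show "0 \<notin> v ` {1..k}" using von by (metis imageE inner_zero_left zero_neq_one)
  qed
  have "\<not> inj_on P (span (v ` {1..k}))"
  proof
    assume i: "inj_on P (span (v ` {1..k}))"
    have "independent (P ` v ` {1..k})"
      by (rule linear_independent_injective_image[OF lin ind i])
    moreover have "P ` v ` {1..k} \<subseteq> span (w ` {1..<k})"
      unfolding P_def by (force intro: span_sum span_scale span_base)
    ultimately have "card (P ` v ` {1..k}) \<le> card (w ` {1..<k})"
      using independent_span_bound by blast
    moreover have "card (P ` v ` {1..k}) = k"
      using inj inj_on_subset[OF i span_superset] by (simp add: card_image)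
    moreover have "card (w ` {1..<k}) \<le> k - 1"
      using card_image_le[of "{1..<k}" w] by simp
    ultimately show False using assms(4) by linarith
  qed
  then obtain u where u: "u \<in> span (v ` {1..k})" "u \<noteq> 0" "P u = 0"
    using linear_injective_on_subspace_0[OF lin subspace_span, of "v ` {1..k}"] by blast
  have "inner u (w j) = 0" if j: "j \<in> {1..<k}" for j
  proof -
    have "inner (P u) (w j) = inner u (w j)"
      unfolding P_def using assms(2) j
      by (subst inner_sum_orthonormal[OF assms(3)]) auto
    then show ?thesis using u(3) by simp
  qed
  with u that show ?thesis by blast
qed

text \<open>Courant-Fischer argument: test both forms on a nonzero \<open>u\<close> in the span of
  the first \<open>k\<close> vectors \<open>q i\<close> that is orthogonal to the first
  \<open>k - 1\<close> vectors \<open>p j\<close>. There the form of \<open>T\<close> is at least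
  \<open>mu k\<close> and that of \<open>S\<close> at most \<open>lam k\<close>, up to the factor
  \<open>(norm u)\<^sup>2\<close>.\<close>

lemma weyl_upper:
  fixes p q :: "nat \<Rightarrow> 'a::{real_inner, banach}"
  assumes I: "basis_index_set I"
    and S: "spectral_decomposition I lam p S" and T: "spectral_decomposition I mu q T"
    and form: "\<And>u. \<bar>inner (S u - T u) u\<bar> \<le> b * (norm u)\<^sup>2"
    and k: "k \<in> I"
  shows "mu k \<le> lam k + b"
proof -
  note q = spectral_decompositionD(1)[OF T]
  have k1: "1 \<le> k" and sub: "{1..k} \<subseteq> I"
    using basis_index_set_pos[OF I k] basis_index_set_down[OF I k] by auto
  obtain u where u: "u \<in> span (q ` {1..k})" "u \<noteq> 0" and up: "\<And>j. j \<in> {1..<k} \<Longrightarrow> inner u (p j) = 0"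
    using exists_span_orthogonal[OF q sub spectral_decompositionD(1)[OF S] k1] by blast
  have uq: "inner u (q i) = 0" if "i \<in> I" "k < i" for i
  proof -
    have "span (q ` {1..k}) \<subseteq> {x. inner x (q i) = 0}"
    proof (rule span_minimal)
      show "q ` {1..k} \<subseteq> {x. inner x (q i) = 0}"
        using that sub by (auto simp: subset_eq orthonormal_basis_onD[OF q])
    qed (auto simp: subspace_def inner_add_left)
    then show ?thesis using u(1) by blast
  qed
  have "mu k * (norm u)\<^sup>2 \<le> inner (T u) u"
  proof (rule spectral_decomposition_form_ge[OF T])
    fix i assume "i \<in> I" "inner u (q i) \<noteq> 0"
    then show "mu k \<le> mu i"
      using uq[of i] basis_index_set_pos[OF I, of i] spectral_decomposition_le[OF I T, of i k]
      by force
  qed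
  moreover have "inner (S u) u \<le> lam k * (norm u)\<^sup>2"
  proof (rule spectral_decomposition_form_le[OF S])
    fix i assume i: "i \<in> I" "inner u (p i) \<noteq> 0"
    then have "k \<le> i" using up[of i] basis_index_set_pos[OF I i(1)] by force
    then show "lam i \<le> lam k" using spectral_decomposition_le[OF I S k1] by blast
  qed
  moreover have "inner (T u) u - inner (S u) u \<le> b * (norm u)\<^sup>2"
    using form[of u] by (simp add: inner_diff_left)
  ultimately have "mu k * (norm u)\<^sup>2 \<le> (lam k + b) * (norm u)\<^sup>2"
    by (simp add: distrib_right)
  then show ?thesis using u(2) by simp
qed

text \<open>An entry with \<open>i \<le> \<tau>\<close> or \<open>k \<le> \<tau>\<close> is bounded by the corresponding entry of \<open>S - T\<close>,
  any other one by \<open>lam i\<close> or \<open>lam k\<close>; the latter needs \<open>c k \<le> lam k\<close> in place of \<open>mu k\<close>.\<close>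

lemma hilbert_schmidt_part_le:
  fixes p q :: "nat \<Rightarrow> 'a::{real_inner, banach}"
  assumes I: "basis_index_set I"
    and S: "spectral_decomposition I lam p S" and T: "spectral_decomposition I mu q T"
    and A: "\<And>x. norm (S x - T x) \<le> b * norm x" and b: "0 \<le> b"
    and f: "K-lipschitz_on UNIV f"
    and c: "\<And>k. k \<in> I \<Longrightarrow> 0 \<le> c k \<and> c k \<le> lam k"
    and lam: "(\<lambda>i. (lam i)\<^sup>2) summable_on {\<tau> + 1..}"
    and F: "finite F" "F \<subseteq> I" and G: "finite G" "G \<subseteq> I"
    and h: "\<And>i k. h i k = (if \<tau> < i \<and> \<tau> < k then f (lam i) - f (c k) else f (lam i) - f (mu k))"
  shows "(\<Sum>i\<in>F. \<Sum>k\<in>G. (h i k * inner (p i) (q k))\<^sup>2)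
    \<le> K\<^sup>2 * (2 * real \<tau> * b\<^sup>2 + 2 * infsum (\<lambda>i. (lam i)\<^sup>2) {\<tau> + 1..})"
proof -
  note p = spectral_decompositionD(1)[OF S] and q = spectral_decompositionD(1)[OF T]
  define m where "m i k = inner (p i) (q k)" for i k
  define d where "d i k = ((lam i - mu k) * m i k)\<^sup>2" for i k
  let ?tail = "infsum (\<lambda>i. (lam i)\<^sup>2) {\<tau> + 1..}"
  have K: "0 \<le> K" using f by (rule lipschitz_on_nonneg)
  have lip: "(f s - f t)\<^sup>2 \<le> K\<^sup>2 * (s - t)\<^sup>2" for s t
  proof -
    have "\<bar>f s - f t\<bar> \<le> \<bar>K * (s - t)\<bar>"
      using lipschitz_onD[OF f, of s t] K by (simp add: dist_real_def abs_mult)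
    then show ?thesis by (simp add: abs_le_square_iff power_mult_distrib)
  qed
  have norm_p: "norm (p i) = 1" if "i \<in> I" for i
    using orthonormal_basis_onD[OF p that that] by (simp add: norm_eq_1)
  have norm_q: "norm (q i) = 1" if "i \<in> I" for i
    using orthonormal_basis_onD[OF q that that] by (simp add: norm_eq_1)
  \<comment> \<open>The numbers squared in row \<open>i\<close> of \<open>d\<close> are the
    coefficients of \<open>S (p i) - T (p i)\<close> in the basis \<open>q\<close>, so Bessel
    applies; columns are treated alike with \<open>p\<close> and \<open>q\<close> exchanged.\<close>
  have row: "(\<Sum>k\<in>G. d i k) \<le> b\<^sup>2" if i: "i \<in> I" for i
  proof -
    have "d i k = (inner (S (p i) - T (p i)) (q k))\<^sup>2" if "k \<in> G" for k
    proof -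
      have "k \<in> I" using that G by blast
      then show ?thesis
        unfolding d_def m_def inner_diff_left spectral_decomposition_symmetric[OF T]
        using i by (simp add: spectral_decompositionD(5)[OF S] spectral_decompositionD(5)[OF T]
            left_diff_distrib)
    qed
    then have "(\<Sum>k\<in>G. d i k) \<le> (norm (S (p i) - T (p i)))\<^sup>2"
      using bessel_ineq[OF q G] by simp
    also have "\<dots> \<le> b\<^sup>2"
      using A[of "p i"] norm_p[OF i] by (intro power_mono) auto
    finally show ?thesis .
  qed
  have col: "(\<Sum>i\<in>F. d i k) \<le> b\<^sup>2" if k: "k \<in> I" for k
  proof -
    have "d i k = (inner (S (q k) - T (q k)) (p i))\<^sup>2" if "i \<in> F" for i
    proof -
      have "i \<in> I" using that F by blast
      then show ?thesis
        unfolding d_def m_def inner_diff_left spectral_decomposition_symmetric[OF S]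
        using k by (simp add: spectral_decompositionD(5)[OF S] spectral_decompositionD(5)[OF T]
            left_diff_distrib inner_commute)
    qed
    then have "(\<Sum>i\<in>F. d i k) \<le> (norm (S (q k) - T (q k)))\<^sup>2"
      using bessel_ineq[OF p F] by simp
    also have "\<dots> \<le> b\<^sup>2"
      using A[of "q k"] norm_q[OF k] by (intro power_mono) auto
    finally show ?thesis .
  qed
  have head: "(\<Sum>i\<in>H. if i \<le> \<tau> then g i else 0) \<le> real \<tau> * b\<^sup>2"
    if "finite H" "H \<subseteq> I" "\<And>i. i \<in> I \<Longrightarrow> g i \<le> b\<^sup>2" for g H
  proof -
    have "(\<Sum>i\<in>H. if i \<le> \<tau> then g i else 0) = (\<Sum>i\<in>{i\<in>H. i \<le> \<tau>}. g i)"
      using that(1) by (simp add: sum.inter_filter)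
    also have "\<dots> \<le> real (card {i\<in>H. i \<le> \<tau>}) * b\<^sup>2"
      by (rule sum_bounded_above) (use that in auto)
    also have "\<dots> \<le> real \<tau> * b\<^sup>2"
    proof -
      have "{i\<in>H. i \<le> \<tau>} \<subseteq> {1..\<tau>}" using that(2) basis_index_set_pos[OF I] by auto
      then have "card {i\<in>H. i \<le> \<tau>} \<le> card {1..\<tau>}" by (intro card_mono) auto
      then show ?thesis by (intro mult_right_mono) auto
    qed
    finally show ?thesis .
  qed
  have tail: "(\<Sum>i\<in>H. if \<tau> < i then g i else 0) \<le> ?tail"
    if "finite H" "H \<subseteq> I" "\<And>i. i \<in> I \<Longrightarrow> g i \<le> (lam i)\<^sup>2" for g H
  proof -
    have "(\<Sum>i\<in>H. if \<tau> < i then g i else 0) = (\<Sum>i\<in>{i\<in>H. \<tau> < i}. g i)"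
      using that(1) by (simp add: sum.inter_filter)
    also have "\<dots> \<le> (\<Sum>i\<in>{i\<in>H. \<tau> < i}. (lam i)\<^sup>2)"
      by (rule sum_mono) (use that in auto)
    also have "\<dots> \<le> ?tail"
      by (rule finite_sum_le_infsum[OF lam]) (use that in auto)
    finally show ?thesis .
  qed
  \<comment> \<open>The first two terms pay for the head rows and columns, the last two for the
    block beyond \<open>\<tau>\<close>. Overlaps are harmless because all four are
    nonnegative.\<close>
  have entry: "(h i k * m i k)\<^sup>2 \<le> K\<^sup>2 * ((if i \<le> \<tau> then d i k else 0) + (if k \<le> \<tau> then d i k else 0)
      + (if \<tau> < i then (lam i * m i k)\<^sup>2 else 0) + (if \<tau> < k then (lam k * m i k)\<^sup>2 else 0))"
    (is "_ \<le> K\<^sup>2 * ?E") if k: "k \<in> I" for i k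
  proof (cases "\<tau> < i \<and> \<tau> < k")
    case True
    have "(f (lam i) - f (c k))\<^sup>2 \<le> K\<^sup>2 * (lam i - c k)\<^sup>2" by (rule lip)
    also have "(lam i - c k)\<^sup>2 \<le> (lam i)\<^sup>2 + (lam k)\<^sup>2"
    proof -
      have "0 \<le> lam i * c k" "(c k)\<^sup>2 \<le> (lam k)\<^sup>2"
        using c[OF k] spectral_decompositionD(2)[OF S, of i] by (simp_all add: power_mono)
      then show ?thesis by (simp add: power2_diff)
    qed
    finally have "(h i k)\<^sup>2 \<le> K\<^sup>2 * ((lam i)\<^sup>2 + (lam k)\<^sup>2)"
      using True by (simp add: h mult_left_mono)
    then have "(h i k)\<^sup>2 * (m i k)\<^sup>2 \<le> K\<^sup>2 * ((lam i)\<^sup>2 + (lam k)\<^sup>2) * (m i k)\<^sup>2"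
      by (rule mult_right_mono) simp
    then show ?thesis using True by (simp add: power_mult_distrib algebra_simps)
  next
    case False
    have "(h i k)\<^sup>2 * (m i k)\<^sup>2 \<le> K\<^sup>2 * (lam i - mu k)\<^sup>2 * (m i k)\<^sup>2"
      using False lip by (intro mult_right_mono) (auto simp: h)
    then have "(h i k * m i k)\<^sup>2 \<le> K\<^sup>2 * d i k"
      by (simp add: d_def power_mult_distrib mult.assoc)
    also have "\<dots> \<le> K\<^sup>2 * ?E"
    proof (rule mult_left_mono)
      have "0 \<le> d i k" by (simp add: d_def)
      then show "d i k \<le> ?E" using False by auto
    qed simp
    finally show ?thesis .
  qed
  have mF: "(\<Sum>i\<in>F. (lam k * m i k)\<^sup>2) \<le> (lam k)\<^sup>2" if k: "k \<in> I" for k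
    using mult_left_mono[OF bessel_ineq[OF p F, of "q k"], of "(lam k)\<^sup>2"] norm_q[OF k]
    by (simp add: m_def power_mult_distrib sum_distrib_left inner_commute)
  have mG: "(\<Sum>k\<in>G. (lam i * m i k)\<^sup>2) \<le> (lam i)\<^sup>2" if i: "i \<in> I" for i
    using mult_left_mono[OF bessel_ineq[OF q G, of "p i"], of "(lam i)\<^sup>2"] norm_p[OF i]
    by (simp add: m_def power_mult_distrib sum_distrib_left)
  have if_sum: "(\<Sum>k\<in>G. if Q then g k else 0) = (if Q then sum g G else 0)" for Q and g :: "nat \<Rightarrow> real"
    by simp
  have "(\<Sum>i\<in>F. \<Sum>k\<in>G. (h i k * m i k)\<^sup>2) \<le> (\<Sum>i\<in>F. \<Sum>k\<in>G. K\<^sup>2 * ((if i \<le> \<tau> then d i k else 0)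
      + (if k \<le> \<tau> then d i k else 0)
      + (if \<tau> < i then (lam i * m i k)\<^sup>2 else 0) + (if \<tau> < k then (lam k * m i k)\<^sup>2 else 0)))"
    using G(2) by (intro sum_mono entry) auto
  \<comment> \<open>Row terms are summed over \<open>k\<close> first and column terms over
    \<open>i\<close> first, so that each inner sum is one of those bounded by \<open>row\<close>,
    \<open>col\<close>, \<open>mG\<close> and \<open>mF\<close>.\<close>
  also have "\<dots> = K\<^sup>2 * ((\<Sum>i\<in>F. if i \<le> \<tau> then \<Sum>k\<in>G. d i k else 0)
      + (\<Sum>k\<in>G. if k \<le> \<tau> then \<Sum>i\<in>F. d i k else 0)
      + (\<Sum>i\<in>F. if \<tau> < i then \<Sum>k\<in>G. (lam i * m i k)\<^sup>2 else 0)
      + (\<Sum>k\<in>G. if \<tau> < k then \<Sum>i\<in>F. (lam k * m i k)\<^sup>2 else 0))"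
  proof -
    have "(\<Sum>k\<in>G. if k \<le> \<tau> then \<Sum>i\<in>F. d i k else 0) = (\<Sum>i\<in>F. \<Sum>k\<in>G. if k \<le> \<tau> then d i k else 0)"
      by (subst sum.swap) (rule sum.cong, simp_all)
    moreover have "(\<Sum>k\<in>G. if \<tau> < k then \<Sum>i\<in>F. (lam k * m i k)\<^sup>2 else 0)
        = (\<Sum>i\<in>F. \<Sum>k\<in>G. if \<tau> < k then (lam k * m i k)\<^sup>2 else 0)"
      by (subst sum.swap) (rule sum.cong, simp_all)
    ultimately show ?thesis
      by (simp only: sum.distrib if_sum sum_distrib_left[symmetric])
  qed
  also have "\<dots> \<le> K\<^sup>2 * (real \<tau> * b\<^sup>2 + real \<tau> * b\<^sup>2 + ?tail + ?tail)"
    by (intro mult_left_mono add_mono head[OF F row] head[OF G col] tail[OF F mG] tail[OF G mF]) simp_all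
  also have "\<dots> = K\<^sup>2 * (2 * real \<tau> * b\<^sup>2 + 2 * ?tail)" by simp
  finally show ?thesis by (simp add: m_def)
qed

section \<open>Cauchy-Schwarz bounds for finite bilinear sums\<close>

text \<open>The double sum is the inner product of two finite combinations, whose norms Pythagoras
  gives. It serves for the error made in replacing \<open>mu k\<close> by
  \<open>c k\<close>.\<close>

lemma sum_mult_orthonormal_le:
  assumes p: "orthonormal_basis_on I p" and q: "orthonormal_basis_on I q"
    and F: "finite F" "F \<subseteq> I" and G: "finite G" "G \<subseteq> I"
  shows "\<bar>\<Sum>i\<in>F. \<Sum>k\<in>G. x i * y k * inner (p i) (q k)\<bar>
    \<le> sqrt (\<Sum>i\<in>F. (x i)\<^sup>2) * sqrt (\<Sum>k\<in>G. (y k)\<^sup>2)"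
proof -
  have "(\<Sum>i\<in>F. \<Sum>k\<in>G. x i * y k * inner (p i) (q k))
      = inner (\<Sum>i\<in>F. x i *\<^sub>R p i) (\<Sum>k\<in>G. y k *\<^sub>R q k)"
    by (subst sum.swap)
      (simp add: inner_sum_left inner_sum_right sum_distrib_left mult.left_commute mult.assoc)
  moreover have "norm (\<Sum>i\<in>F. x i *\<^sub>R p i) = sqrt (\<Sum>i\<in>F. (x i)\<^sup>2)"
    by (metis norm_sum_orthonormal[OF p F] real_sqrt_abs abs_norm_cancel)
  moreover have "norm (\<Sum>k\<in>G. y k *\<^sub>R q k) = sqrt (\<Sum>k\<in>G. (y k)\<^sup>2)"
    by (metis norm_sum_orthonormal[OF q G] real_sqrt_abs abs_norm_cancel)
  ultimately show ?thesis using Cauchy_Schwarz_ineq2 by metis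
qed

text \<open>Cauchy-Schwarz over index pairs: the Hilbert-Schmidt norm of a finite matrix dominates
  its operator norm.\<close>

lemma sum_mult_hilbert_schmidt_le:
  fixes x y :: "nat \<Rightarrow> real"
  assumes "(\<Sum>i\<in>F. \<Sum>k\<in>G. (z i k)\<^sup>2) \<le> C"
  shows "\<bar>\<Sum>i\<in>F. \<Sum>k\<in>G. x i * y k * z i k\<bar>
    \<le> sqrt C * (sqrt (\<Sum>i\<in>F. (x i)\<^sup>2) * sqrt (\<Sum>k\<in>G. (y k)\<^sup>2))"
proof -
  let ?P = "F \<times> G"
  have "(\<Sum>i\<in>F. \<Sum>k\<in>G. x i * y k * z i k)\<^sup>2 = (\<Sum>(i, k)\<in>?P. (x i * y k) * z i k)\<^sup>2"
    by (simp add: sum.cartesian_product)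
  also have "\<dots> \<le> (\<Sum>(i, k)\<in>?P. (x i * y k)\<^sup>2) * (\<Sum>(i, k)\<in>?P. (z i k)\<^sup>2)"
    using Cauchy_Schwarz_ineq_sum[of "\<lambda>(i, k). x i * y k" "\<lambda>(i, k). z i k" ?P]
    by (simp add: case_prod_unfold)
  also have "\<dots> = ((\<Sum>i\<in>F. (x i)\<^sup>2) * (\<Sum>k\<in>G. (y k)\<^sup>2)) * (\<Sum>i\<in>F. \<Sum>k\<in>G. (z i k)\<^sup>2)"
    by (simp add: sum.cartesian_product[symmetric] sum_product power_mult_distrib)
  also have "\<dots> \<le> ((\<Sum>i\<in>F. (x i)\<^sup>2) * (\<Sum>k\<in>G. (y k)\<^sup>2)) * C"
    using assms by (intro mult_left_mono mult_nonneg_nonneg sum_nonneg) auto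
  finally have "sqrt ((\<Sum>i\<in>F. \<Sum>k\<in>G. x i * y k * z i k)\<^sup>2)
      \<le> sqrt (((\<Sum>i\<in>F. (x i)\<^sup>2) * (\<Sum>k\<in>G. (y k)\<^sup>2)) * C)"
    by (rule real_sqrt_le_mono)
  then show ?thesis by (simp add: real_sqrt_mult mult.commute)
qed

section \<open>The deterministic perturbation bound\<close>

text \<open>Finite sections of the matrix of the difference are bounded first. Testing
  \<open>D\<close> against its own partial sum \<open>?v\<close> in the basis \<open>p\<close> then
  gives \<open>(norm ?v)\<^sup>2\<close> on one side and a multiple of
  \<open>norm ?v * norm u\<close> on the other; after cancelling, the partial sums tend to
  \<open>D\<close>.\<close>

lemma spectral_fun_diff_le:
  fixes p q :: "nat \<Rightarrow> 'a::{real_inner, banach}"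
  assumes I: "basis_index_set I"
    and S: "spectral_decomposition I lam p S" and T: "spectral_decomposition I mu q T"
    and form: "\<And>u. \<bar>inner (S u - T u) u\<bar> \<le> b * (norm u)\<^sup>2" and b: "0 \<le> b"
    and f: "K-lipschitz_on UNIV f"
    and lam: "(\<lambda>i. (lam i)\<^sup>2) summable_on {\<tau> + 1..}"
  shows "norm (spectral_fun I lam p f u - spectral_fun I mu q f u)
    \<le> K * (b + sqrt (2 * real \<tau> * b\<^sup>2 + 2 * infsum (\<lambda>i. (lam i)\<^sup>2) {\<tau> + 1..})) * norm u"
proof -
  note p = spectral_decompositionD(1)[OF S] and q = spectral_decompositionD(1)[OF T]
  let ?tail = "infsum (\<lambda>i. (lam i)\<^sup>2) {\<tau> + 1..}"
  let ?R = "sqrt (2 * real \<tau> * b\<^sup>2 + 2 * ?tail)"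
  define D where "D = spectral_fun I lam p f u - spectral_fun I mu q f u"
  define c where "c k = max (mu k - b) 0" for k
  have K: "0 \<le> K" using f by (rule lipschitz_on_nonneg)
  have A: "norm (S x - T x) \<le> b * norm x" for x
  proof (rule norm_le_of_form_le[where A = "\<lambda>x. S x - T x"])
    show "linear (\<lambda>x. S x - T x)"
      by (intro linear_compose_sub spectral_decomposition_linear[OF S] spectral_decomposition_linear[OF T])
      show "inner (S x - T x) y = inner x (S y - T y)" for x y
      by (simp add: inner_diff_left inner_diff_right
          spectral_decomposition_symmetric[OF S] spectral_decomposition_symmetric[OF T])
  qed (rule form)
  have c: "0 \<le> c k \<and> c k \<le> lam k" if "k \<in> I" for k
    using weyl_upper[OF I S T form that] spectral_decompositionD(2)[OF S, of k] by (auto simp: c_def)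
  have fc: "\<bar>f (c k) - f (mu k)\<bar> \<le> K * b" for k
  proof -
    have "\<bar>f (c k) - f (mu k)\<bar> \<le> K * \<bar>c k - mu k\<bar>"
      using lipschitz_onD[OF f, of "c k" "mu k"] by (simp add: dist_real_def)
    also have "\<bar>c k - mu k\<bar> \<le> b"
      using spectral_decompositionD(2)[OF T, of k] b by (auto simp: c_def)
    finally show ?thesis using K by (simp add: mult_left_mono)
  qed
  have finite_bound: "\<bar>\<Sum>i\<in>F. \<Sum>k\<in>G. x i * y k * ((f (lam i) - f (mu k)) * inner (p i) (q k))\<bar>
      \<le> K * (b + ?R) * (sqrt (\<Sum>i\<in>F. (x i)\<^sup>2) * sqrt (\<Sum>k\<in>G. (y k)\<^sup>2))"
    if F: "finite F" "F \<subseteq> I" and G: "finite G" "G \<subseteq> I" for F G x y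
  proof -
    \<comment> \<open>On the block beyond \<open>\<tau>\<close>, what \<open>h\<close> leaves out is
      \<open>f (c k) - f (mu k)\<close>, which depends on \<open>k\<close> alone. It can be absorbed
      into \<open>y'\<close>, so the remainder is a bilinear sum with the bare entries
      \<open>inner (p i) (q k)\<close>.\<close>
    define h where "h i k = (if \<tau> < i \<and> \<tau> < k then f (lam i) - f (c k) else f (lam i) - f (mu k))" for i k
    define x' where "x' i = (if \<tau> < i then x i else 0)" for i
    define y' where "y' k = (if \<tau> < k then y k * (f (c k) - f (mu k)) else 0)" for k
    let ?N = "sqrt (\<Sum>i\<in>F. (x i)\<^sup>2) * sqrt (\<Sum>k\<in>G. (y k)\<^sup>2)"
    have "(\<Sum>i\<in>F. \<Sum>k\<in>G. x i * y k * ((f (lam i) - f (mu k)) * inner (p i) (q k)))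
        = (\<Sum>i\<in>F. \<Sum>k\<in>G. x i * y k * (h i k * inner (p i) (q k)))
          + (\<Sum>i\<in>F. \<Sum>k\<in>G. x' i * y' k * inner (p i) (q k))"
      unfolding sum.distrib[symmetric]
      by (intro sum.cong) (auto simp: h_def x'_def y'_def algebra_simps)
    moreover have "\<bar>\<Sum>i\<in>F. \<Sum>k\<in>G. x i * y k * (h i k * inner (p i) (q k))\<bar> \<le> K * ?R * ?N"
      using sum_mult_hilbert_schmidt_le[OF hilbert_schmidt_part_le[OF I S T A b f c lam F G h_def], of x y] K
      by (simp add: real_sqrt_mult)
    moreover have "\<bar>\<Sum>i\<in>F. \<Sum>k\<in>G. x' i * y' k * inner (p i) (q k)\<bar> \<le> K * b * ?N"
    proof -
      have "(\<Sum>i\<in>F. (x' i)\<^sup>2) \<le> (\<Sum>i\<in>F. (x i)\<^sup>2)"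
        by (intro sum_mono) (auto simp: x'_def)
      moreover have "(\<Sum>k\<in>G. (y' k)\<^sup>2) \<le> (K * b)\<^sup>2 * (\<Sum>k\<in>G. (y k)\<^sup>2)"
        unfolding sum_distrib_left
      proof (rule sum_mono)
        fix k
        have "(f (c k) - f (mu k))\<^sup>2 \<le> (K * b)\<^sup>2"
          using fc[of k] power_mono[OF fc, of k 2] by simp
        then show "(y' k)\<^sup>2 \<le> (K * b)\<^sup>2 * (y k)\<^sup>2"
          by (auto simp: y'_def power_mult_distrib mult.commute[of "(y k)\<^sup>2"] intro: mult_right_mono)
      qed
      then have "sqrt (\<Sum>k\<in>G. (y' k)\<^sup>2) \<le> K * b * sqrt (\<Sum>k\<in>G. (y k)\<^sup>2)"
        using K b by (intro real_le_lsqrt) (simp_all add: power_mult_distrib sum_nonneg)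
      ultimately have "sqrt (\<Sum>i\<in>F. (x' i)\<^sup>2) * sqrt (\<Sum>k\<in>G. (y' k)\<^sup>2)
          \<le> sqrt (\<Sum>i\<in>F. (x i)\<^sup>2) * (K * b * sqrt (\<Sum>k\<in>G. (y k)\<^sup>2))"
        by (intro mult_mono) (auto intro: sum_nonneg)
      then show ?thesis
        using sum_mult_orthonormal_le[OF p q F G, of x' y'] by (simp add: ac_simps)
    qed
    ultimately show ?thesis by (simp add: algebra_simps)
  qed
  have test: "norm (\<Sum>i\<in>F. inner D (p i) *\<^sub>R p i) \<le> K * (b + ?R) * norm u"
    if F: "finite F" "F \<subseteq> I" for F
  proof -
    let ?v = "\<Sum>i\<in>F. inner D (p i) *\<^sub>R p i"
    have nv: "norm ?v = sqrt (\<Sum>i\<in>F. (inner D (p i))\<^sup>2)"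
      by (metis norm_sum_orthonormal[OF p F] real_sqrt_abs abs_norm_cancel)
    \<comment> \<open>To reach the entries between the two bases,
      \<open>f (lam i) * inner u (p i)\<close> is expanded along \<open>q\<close> by Parseval and
      the series for the second operator is subtracted.\<close>
    have coef: "((\<lambda>k. inner u (q k) * ((f (lam i) - f (mu k)) * inner (p i) (q k))) has_sum inner D (p i)) I"
      if i: "i \<in> I" for i
    proof -
      have 1: "inner (spectral_fun I lam p f u) (p i) = f (lam i) * inner u (p i)"
        by (rule has_sum_inner_orthonormal[OF p spectral_fun_has_sum[OF I S f] i])
      have 2: "((\<lambda>k. f (lam i) * (inner u (q k) * inner (q k) (p i))) has_sum f (lam i) * inner u (p i)) I"
        by (rule has_sum_cmult_right[OF parseval[OF q]])
      have 3: "((\<lambda>k. inner ((f (mu k) * inner u (q k)) *\<^sub>R q k) (p i)) has_sum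
          inner (spectral_fun I mu q f u) (p i)) I"
        by (rule has_sum_inner_left[OF spectral_fun_has_sum[OF I T f]])
      show ?thesis
        using has_sum_add[OF 2 has_sum_uminusI[OF 3]]
        by
          (simp add: D_def inner_diff_left 1 inner_commute[of "q k" "p i" for k] algebra_simps)
    qed
    have "((\<lambda>k. \<Sum>i\<in>F. inner D (p i) * (inner u (q k) * ((f (lam i) - f (mu k)) * inner (p i) (q k))))
        has_sum (\<Sum>i\<in>F. inner D (p i) * inner D (p i))) I"
      by (intro has_sum_finite_sum has_sum_cmult_right coef) (use F in auto)
    \<comment> \<open>Only finite sections in \<open>k\<close> need a bound, since the limit
      inherits it.\<close>
    then have "(\<Sum>i\<in>F. inner D (p i) * inner D (p i)) \<le> K * (b + ?R) * (norm ?v * norm u)"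
    proof (rule has_sum_le_finite_sums)
      fix G assume G: "finite G" "G \<subseteq> I"
      have "(\<Sum>k\<in>G. \<Sum>i\<in>F. inner D (p i) * (inner u (q k) * ((f (lam i) - f (mu k)) * inner (p i) (q k))))
          \<le> K * (b + ?R) * (norm ?v * sqrt (\<Sum>k\<in>G. (inner u (q k))\<^sup>2))"
        using finite_bound[OF F G, of "\<lambda>i. inner D (p i)" "\<lambda>k. inner u (q k)"]
        by (subst sum.swap) (simp add: nv mult.assoc)
      also have "\<dots> \<le> K * (b + ?R) * (norm ?v * norm u)"
      proof (intro mult_left_mono)
        show "sqrt (\<Sum>k\<in>G. (inner u (q k))\<^sup>2) \<le> norm u"
          using bessel_ineq[OF q G] by (simp add: real_le_lsqrt sum_nonneg)
        have "0 \<le> ?tail" by (rule infsum_nonneg) simp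
        then show "0 \<le> K * (b + ?R)" using K b by simp
      qed simp
      finally show "(\<Sum>k\<in>G. \<Sum>i\<in>F. inner D (p i) * (inner u (q k) * ((f (lam i) - f (mu k)) * inner (p i) (q k))))
          \<le> K * (b + ?R) * (norm ?v * norm u)" .
    qed
    moreover have "(\<Sum>i\<in>F. inner D (p i) * inner D (p i)) = norm ?v * norm ?v"
      using norm_sum_orthonormal[OF p F, of "\<lambda>i. inner D (p i)"] by (simp add: power2_eq_square)
    ultimately have le: "norm ?v * norm ?v \<le> (K * (b + ?R) * norm u) * norm ?v"
      by (simp add: ac_simps)
    show ?thesis
    proof (cases "norm ?v = 0")
      case True
      have "0 \<le> ?tail" by (rule infsum_nonneg) simp
      then show ?thesis unfolding True using K b by simp
    next
      case False
      then have "0 < norm ?v" by simp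
      then show ?thesis using le mult_right_le_imp_le by blast
    qed
  qed
  have "(sum (\<lambda>i. inner D (p i) *\<^sub>R p i) \<longlongrightarrow> D) (finite_subsets_at_top I)"
    using orthonormal_expansion[OF p, of D] by (simp add: has_sum_def)
  then have "norm D \<le> K * (b + ?R) * norm u"
    by (rule Lim_norm_ubound[OF finite_subsets_at_top_neq_bot])
      (rule eventually_finite_subsets_at_top_weakI, rule test)
  then show ?thesis by (simp add: D_def)
qed

section \<open>Passage to the probabilistic statement\<close>

text \<open>The diagonal entries of \<open>S\<close> are the eigenvalues, so the trace condition
  makes \<open>lam\<close> summable; boundedness of \<open>lam\<close> passes this to the squares.
  Zero padding extends it to all of \<open>UNIV\<close>, hence to any \<open>J\<close>. The tail
  sums are thus genuine and not the default 0.\<close>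

lemma spectral_decomposition_summable_square:
  assumes S: "spectral_decomposition I lam p S" and tr: "finite_trace I p S"
  shows "(\<lambda>i. (lam i)\<^sup>2) summable_on J"
proof -
  note p = spectral_decompositionD(1)[OF S]
  have "(\<lambda>i. inner (S (p i)) (p i)) summable_on I"
    using tr by (simp add: finite_trace_def)
  then have "lam summable_on I"
    by (rule summable_on_cong[THEN iffD1, rotated])
      (simp add: spectral_decompositionD(5)[OF S] orthonormal_basis_onD[OF p])
  then have sum: "lam summable_on UNIV"
    by (rule summable_on_cong_neutral[THEN iffD1, rotated -1])
      (auto simp: spectral_decompositionD(4)[OF S])
  have "Bseq lam"
    using S by (auto simp: spectral_decomposition_def intro: convergent_imp_Bseq convergentI)
  then obtain C where C: "\<And>i. norm (lam i) \<le> C" by (auto simp: Bseq_def)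
  have "(\<lambda>i. C * lam i) summable_on UNIV" by (rule summable_on_cmult_right[OF sum])
  then have "(\<lambda>i. (lam i)\<^sup>2) summable_on UNIV"
  proof (rule summable_on_comparison_test)
    show "(lam i)\<^sup>2 \<le> C * lam i" for i
      using C[of i] spectral_decompositionD(2)[OF S, of i]
      by (simp add: power2_eq_square mult_right_mono)
  qed simp
  then show ?thesis using summable_on_subset_banach by blast
qed

theorem proposition3p2:
  fixes M :: "'w measure"
    and X :: "'w \<Rightarrow> 'a::{real_inner, banach, second_countable_topology}"
    and Y :: "nat \<Rightarrow> 'w \<Rightarrow> 'a"
    and n :: nat
    and est :: "(nat \<Rightarrow> 'a) \<Rightarrow> 'a \<Rightarrow> 'a"
    and Cov :: "'a \<Rightarrow> 'a"
    and Cov_hat :: "'w \<Rightarrow> 'a \<Rightarrow> 'a"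
    and I :: "nat set"
    and lam :: "nat \<Rightarrow> real" and p :: "nat \<Rightarrow> 'a"
    and lam_hat :: "'w \<Rightarrow> nat \<Rightarrow> real" and q :: "'w \<Rightarrow> nat \<Rightarrow> 'a"
    and B :: "real \<Rightarrow> real"
    and \<epsilon> :: real
  assumes "prob_space M"
    and "X \<in> borel_measurable M"
    and "has_covariance_operator M X"
    and "Cov = covariance_operator M X"
    and "iid_sample M X n Y"
    and "operator_estimator n est"
    and "\<And>\<omega>. \<omega> \<in> space M \<Longrightarrow> Cov_hat \<omega> = est (\<lambda>i\<in>{1..n}. Y i \<omega>)"
    and "basis_index_set I"
    and "spectral_decomposition I lam p Cov"
    and "finite_trace I p Cov"
    and "\<And>\<omega>. \<omega> \<in> space M \<Longrightarrow> spectral_decomposition I (lam_hat \<omega>) (q \<omega>) (Cov_hat \<omega>)"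
    and "\<And>t. 0 \<le> t \<Longrightarrow> 0 \<le> B t"
    and "mono_on {0..} B"
    and "\<And>t a. 0 \<le> t \<Longrightarrow> 0 \<le> a \<Longrightarrow> B (t + a) \<le> B t + a / 2"
    and "0 < \<epsilon>" and "\<epsilon> < 1"
    and "with_prob_at_least M (1 - \<epsilon>) (\<lambda>\<omega>. \<forall>u. norm u = 1 \<longrightarrow>
           \<bar>inner (Cov u) u - inner (Cov_hat \<omega> u) u\<bar> \<le> B (inner (Cov u) u) \<and>
           \<bar>inner (Cov u) u - inner (Cov_hat \<omega> u) u\<bar> \<le> B (inner (Cov_hat \<omega> u) u))"
  shows "with_prob_at_least M (1 - \<epsilon>) (\<lambda>\<omega>. \<forall>L>0. \<forall>f. (1 / L)-lipschitz_on UNIV f \<longrightarrow>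
           onorm (\<lambda>u. spectral_fun I lam p f u - spectral_fun I (lam_hat \<omega>) (q \<omega>) f u)
             \<le> (INF \<tau>\<in>{1..}. 1 / L * (B (lam 1) +
                  sqrt (4 * real \<tau> * (B (lam 1))\<^sup>2 + 2 * infsum (\<lambda>i. (lam i)\<^sup>2) {\<tau> + 1..}))))"
proof -
  note I = assms(8) and S = assms(9) and mono = assms(13)
  let ?b = "B (lam 1)"
  have lam1: "0 \<le> lam 1" by (rule spectral_decompositionD(2)[OF S])
  have b: "0 \<le> ?b" by (rule assms(12)[OF lam1])
  obtain A where A: "A \<in> sets M" "1 - \<epsilon> \<le> measure M A"
    and good: "\<And>\<omega> u. \<omega> \<in> A \<Longrightarrow> norm u = 1
      \<Longrightarrow> \<bar>inner (Cov u) u - inner (Cov_hat \<omega> u) u\<bar> \<le> B (inner (Cov u) u)"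
    using assms(17) unfolding with_prob_at_least_def by blast
  have "onorm (\<lambda>u. spectral_fun I lam p f u - spectral_fun I (lam_hat \<omega>) (q \<omega>) f u)
      \<le> 1 / L * (?b + sqrt (4 * real \<tau> * ?b\<^sup>2 + 2 * infsum (\<lambda>i. (lam i)\<^sup>2) {\<tau> + 1..}))"
    (is "_ \<le> ?rhs")
    if \<omega>: "\<omega> \<in> A" and f: "(1 / L)-lipschitz_on UNIV f" for \<omega> L f \<tau>
  proof -
    have T: "spectral_decomposition I (lam_hat \<omega>) (q \<omega>) (Cov_hat \<omega>)"
      using assms(11) \<omega> sets.sets_into_space[OF A(1)] by blast
    \<comment> \<open>The form of \<open>Cov\<close> lies between 0 and \<open>lam 1\<close> on unit
      vectors, so monotonicity of \<open>B\<close> makes the bound uniform.\<close>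
    have unit: "\<bar>inner (Cov u - Cov_hat \<omega> u) u\<bar> \<le> ?b" if u: "norm u = 1" for u
    proof -
      have "inner (Cov u) u \<le> lam 1"
        using spectral_decomposition_form_le[OF S, of u "lam 1"] u
          spectral_decomposition_le[OF I S] basis_index_set_pos[OF I] by fastforce
      moreover have "0 \<le> inner (Cov u) u"
        using spectral_decomposition_form_ge[OF S, of u 0] spectral_decompositionD(2)[OF S] by simp
      ultimately have "B (inner (Cov u) u) \<le> ?b"
        using mono lam1 by (auto simp: mono_on_def)
      then show ?thesis using good[OF \<omega> u] by (simp add: inner_diff_left)
    qed
    \<comment> \<open>Both sides are homogeneous of degree 2, so it suffices to normalise
      \<open>u\<close>.\<close>
    have form: "\<bar>inner (Cov u - Cov_hat \<omega> u) u\<bar> \<le> ?b * (norm u)\<^sup>2" for u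
    proof (cases "u = 0")
      case False
      define v where "v = (1 / norm u) *\<^sub>R u"
      have "norm v = 1" and uv: "u = norm u *\<^sub>R v" using False by (simp_all add: v_def)
      have "inner (Cov u - Cov_hat \<omega> u) u = (norm u)\<^sup>2 * inner (Cov v - Cov_hat \<omega> v) v"
        by (subst (1 2 3) uv)
          (simp add: linear_cmul[OF spectral_decomposition_linear[OF S]]
            linear_cmul[OF spectral_decomposition_linear[OF T]]
            scaleR_diff_right[symmetric] power2_eq_square)
      then show ?thesis
        using mult_left_mono[OF unit[OF \<open>norm v = 1\<close>], of "(norm u)\<^sup>2"]
        by (simp add: abs_mult mult.commute)
    qed simp
    show ?thesis
    proof (rule onorm_bound)
      have tail: "0 \<le> infsum (\<lambda>i. (lam i)\<^sup>2) {\<tau> + 1..}" by (rule infsum_nonneg) simp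
      have K: "0 \<le> 1 / L" using f by (rule lipschitz_on_nonneg)
      show "0 \<le> ?rhs"
        by (intro mult_nonneg_nonneg[OF K] add_nonneg_nonneg[OF b] real_sqrt_ge_zero) (use tail in simp)
      fix u
      have "norm (spectral_fun I lam p f u - spectral_fun I (lam_hat \<omega>) (q \<omega>) f u)
          \<le> 1 / L * (?b + sqrt (2 * real \<tau> * ?b\<^sup>2 + 2 * infsum (\<lambda>i. (lam i)\<^sup>2) {\<tau> + 1..})) * norm u"
        by (rule spectral_fun_diff_le[OF I S T form b f
              spectral_decomposition_summable_square[OF S assms(10)]])
      also have "\<dots> \<le> ?rhs * norm u"
        by (intro mult_right_mono mult_left_mono[OF _ K] add_left_mono real_sqrt_le_mono
            add_right_mono) simp_all
      finally show "norm (spectral_fun I lam p f u - spectral_fun I (lam_hat \<omega>) (q \<omega>) f u)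
          \<le> ?rhs * norm u" .
    qed
  qed
  \<comment> \<open>The event \<open>A\<close> was fixed before \<open>L\<close>, \<open>f\<close>
    and \<open>\<tau>\<close>, so it serves all of them at once; a bound valid for each
    \<open>\<tau>\<close> passes to the infimum over the nonempty set \<open>{1..}\<close>.\<close>
  then have "\<forall>\<omega>\<in>A. \<forall>L>0. \<forall>f. (1 / L)-lipschitz_on UNIV f \<longrightarrow>
      onorm (\<lambda>u. spectral_fun I lam p f u - spectral_fun I (lam_hat \<omega>) (q \<omega>) f u)
        \<le> (INF \<tau>\<in>{1..}. 1 / L * (?b + sqrt (4 * real \<tau> * ?b\<^sup>2 + 2 * infsum (\<lambda>i. (lam i)\<^sup>2) {\<tau> + 1..})))"
    by (intro ballI allI impI cINF_greatest) auto
  then show ?thesis using A unfolding with_prob_at_least_def by blast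
qed

end
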